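(* Let $P$ be defined by a set of no-good constraints: let $S\subseteq\{0,1\}^n$ and $$P=\Big\{x\in[0,1]^n:\ \sum_{j:s_j=0}x_j+\sum_{j:s_j=1}(1-x_j)\ge\tfrac12\ \ \forall\, s\in S\Big\}.$$ There is a branch-and-bound tree $\mathcal{T}$ of size at most $3n|S|$ such that $\mathcal{T}(P)=P_I$. Furthermore, $SA^{n-1}(P)\ne P_I$ when $|S|=1$, and $L^{n-1}(P)\ne P_I$ if there exists $z\in S$ such that $\{z':\|z'-z\|_1=1\}\cap S=\emptyset$.
   Context: $n$ is a positive integer (the dimension) and $[n]=\{1,\dots,n\}$. For a polytope $P\subseteq[0,1]^n$, $P_I:=\mathrm{conv}(P\cap\{0,1\}^n)$. A branch-and-bound tree $\mathcal{T}$ is a rooted binary tree in which each node has $0$ or $2$ children. Each node $v$ carries a set $C_v$ of branching constraints. The root has $C_{\mathrm{root}}=\emptyset$. If a node $v$ has two children, they are obtained by branching on a variable $x_j$, $j\in[n]$, not already branched on at an ancestor of $v$: one child has branching constraints $C_v\cup\{x_j=0\}$ and the other $C_v\cup\{x_j=1\}$. The size of $\mathcal{T}$ is its number of nodes. For a polytope $P$, the atom of $v$ is $P_v:=P\cap\{x:C_v\}$ (points of $P$ satisfying all constraints in $C_v$), and $\mathcal{T}(P):=\mathrm{conv}\big(\bigcup_{v\in\mathrm{leaves}(\mathcal{T})}P_v\big)$. Lift-and-project: $L(P):=\bigcap_{i\in[n]}\mathrm{conv}\big((P\cap\{x:x_i=0\})\cup(P\cap\{x:x_i=1\})\big)$,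 $L^0(P):=P$, and $L^k(P):=L(L^{k-1}(P))$ for $k\ge1$. Sherali-Adams: $SA^k(P)$ is the $k$th level polytope in the Sherali-Adams hierarchy, defined as follows. Let $P$ be described by a finite system of linear inequalities that includes $0\le x_i\le 1$ for $i\in[n]$. For each inequality $ax-b\ge0$ of the system and each pair of disjoint sets $I,J\subseteq[n]$ with $|I|+|J|\le k$, form $(ax-b)\prod_{i\in I}x_i\prod_{j\in J}(1-x_j)\ge 0$, expand, replace each $x_i^2$ by $x_i$, and replace each monomial $\prod_{i\in S'}x_i$ by a variable $y_{S'}$, with $y_\emptyset=1$ and $y_{\{i\}}=x_i$. $SA^k(P)$ is the projection onto the $x$-space of the polyhedron defined by the resulting linear inequalities; $SA^0(P)=P$.
   Formalization: The set S is assumed non-empty: for S empty the claimed size bound 3n|S| is 0, while every branch-and-bound tree has at least one node, so the first claim fails there; the other two claims are vacuous in that case. *)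

theory Defs
  imports "HOL-Analysis.Analysis" "HOL-Library.Poly_Mapping"
begin

definition zero_one_points :: "(real ^ 'n) set" where
  "zero_one_points = {x. \<forall>i. x $ i = 0 \<or> x $ i = 1}"

definition integer_hull :: "(real ^ 'n) set \<Rightarrow> (real ^ 'n) set" where
  "integer_hull P = convex hull (P \<inter> zero_one_points)"

definition l1_norm :: "real ^ 'n \<Rightarrow> real" where
  "l1_norm x = (\<Sum>i\<in>UNIV. \<bar>x $ i\<bar>)"

definition no_good_polytope :: "(real ^ 'n) set \<Rightarrow> (real ^ 'n) set" where
  "no_good_polytope S =
     {x. (\<forall>i. 0 \<le> x $ i \<and> x $ i \<le> 1) \<and>
         (\<forall>s\<in>S. (\<Sum>j\<in>{j. s $ j = 0}. x $ j) + (\<Sum>j\<in>{j. s $ j = 1}. 1 - x $ j) \<ge> 1 / 2)}"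

text \<open>In \<open>Branch j l r\<close> the child \<open>l\<close> is the one with \<open>x\<^sub>j = 0\<close> and \<open>r\<close> the one with
  \<open>x\<^sub>j = 1\<close>. The constraint set of a node is not stored but computed along the path from
  the root; the pair \<open>(j, c)\<close> stands for the branching constraint \<open>x\<^sub>j = c\<close>.\<close>

datatype 'n bb_tree = Leaf | Branch 'n "'n bb_tree" "'n bb_tree"

fun num_nodes :: "'n bb_tree \<Rightarrow> nat" where
  "num_nodes Leaf = 1"
| "num_nodes (Branch j l r) = 1 + num_nodes l + num_nodes r"

fun admissible_below :: "('n \<times> real) set \<Rightarrow> 'n bb_tree \<Rightarrow> bool" where
  "admissible_below C Leaf \<longleftrightarrow> True"
| "admissible_below C (Branch j l r) \<longleftrightarrow>
     j \<notin> fst ` C \<and> admissible_below (insert (j, 0) C) l \<and> admissible_below (insert (j, 1) C) r"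

definition branch_and_bound_tree :: "'n bb_tree \<Rightarrow> bool" where
  "branch_and_bound_tree T \<longleftrightarrow> admissible_below {} T"

fun leaf_constraints_below :: "('n \<times> real) set \<Rightarrow> 'n bb_tree \<Rightarrow> ('n \<times> real) set set" where
  "leaf_constraints_below C Leaf = {C}"
| "leaf_constraints_below C (Branch j l r) =
     leaf_constraints_below (insert (j, 0) C) l \<union> leaf_constraints_below (insert (j, 1) C) r"

definition leaf_constraints :: "'n bb_tree \<Rightarrow> ('n \<times> real) set set" where
  "leaf_constraints T = leaf_constraints_below {} T"

definition atom :: "(real ^ 'n) set \<Rightarrow> ('n \<times> real) set \<Rightarrow> (real ^ 'n) set" where
  "atom P C = P \<inter> {x. \<forall>(j, c)\<in>C. x $ j = c}"

definition tree_hull :: "'n bb_tree \<Rightarrow> (real ^ 'n) set \<Rightarrow> (real ^ 'n) set" where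
  "tree_hull T P = convex hull (\<Union>C\<in>leaf_constraints T. atom P C)"

definition lift_project :: "(real ^ 'n) set \<Rightarrow> (real ^ 'n) set" where
  "lift_project P =
     (\<Inter>i. convex hull ((P \<inter> {x. x $ i = 0}) \<union> (P \<inter> {x. x $ i = 1})))"

abbreviation lift_project_iter :: "nat \<Rightarrow> (real ^ 'n) set \<Rightarrow> (real ^ 'n) set" where
  "lift_project_iter k P \<equiv> (lift_project ^^ k) P"

text \<open>A system of linear inequalities is a set of pairs; \<open>(a, b)\<close> stands for
  \<open>a \<bullet> x - b \<ge> 0\<close>.\<close>

definition solutions :: "((real ^ 'n) \<times> real) set \<Rightarrow> (real ^ 'n) set" where
  "solutions A = {x. \<forall>(a, b)\<in>A. a \<bullet> x - b \<ge> 0}"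

definition bound_inequalities :: "((real ^ 'n) \<times> real) set" where
  "bound_inequalities = (\<Union>i. {(axis i 1, 0), (- axis i 1, - 1)})"

definition describes :: "((real ^ 'n) \<times> real) set \<Rightarrow> (real ^ 'n) set \<Rightarrow> bool" where
  "describes A P \<longleftrightarrow> finite A \<and> bound_inequalities \<subseteq> A \<and> solutions A = P"

text \<open>Polynomials in the variables \<open>x\<^sub>i\<close>: a monomial maps each variable to its exponent.\<close>

type_synonym 'n polynomial = "('n \<Rightarrow>\<^sub>0 nat) \<Rightarrow>\<^sub>0 real"

definition var :: "'n \<Rightarrow> 'n polynomial" where
  "var i = Poly_Mapping.single (Poly_Mapping.single i 1) 1"

definition const :: "real \<Rightarrow> 'n polynomial" where
  "const c = Poly_Mapping.single 0 c"

definition sa_polynomial :: "real ^ 'n \<Rightarrow> real \<Rightarrow> 'n set \<Rightarrow> 'n set \<Rightarrow> 'n polynomial" where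
  "sa_polynomial a b I J =
     ((\<Sum>i\<in>UNIV. const (a $ i) * var i) - const b) * (\<Prod>i\<in>I. var i) * (\<Prod>j\<in>J. 1 - var j)"

text \<open>Replacing \<open>x\<^sub>i\<^sup>2\<close> by \<open>x\<^sub>i\<close> turns a monomial \<open>m\<close> into the product of the \<open>x\<^sub>i\<close> over its
  support \<open>Poly_Mapping.keys m\<close>, which is then replaced by the variable indexed by that support.\<close>

definition linearize :: "('n set \<Rightarrow> real) \<Rightarrow> 'n polynomial \<Rightarrow> real" where
  "linearize y p =
     (\<Sum>m\<in>Poly_Mapping.keys p. Poly_Mapping.lookup p m * y (Poly_Mapping.keys m))"

definition sa_lifted :: "nat \<Rightarrow> ((real ^ 'n) \<times> real) set \<Rightarrow> ('n set \<Rightarrow> real) set" where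
  "sa_lifted k A =
     {y. y {} = 1 \<and>
         (\<forall>(a, b)\<in>A. \<forall>I J. I \<inter> J = {} \<and> card I + card J \<le> k \<longrightarrow>
            linearize y (sa_polynomial a b I J) \<ge> 0)}"

definition sherali_adams :: "nat \<Rightarrow> ((real ^ 'n) \<times> real) set \<Rightarrow> (real ^ 'n) set" where
  "sherali_adams k A = (\<lambda>y. \<chi> i. y {i}) ` sa_lifted k A"

lemma linearize_superset:
  assumes "finite M" "Poly_Mapping.keys p \<subseteq> M"
  shows "linearize y p = (\<Sum>m\<in>M. Poly_Mapping.lookup p m * y (Poly_Mapping.keys m))"
  unfolding linearize_def
  by (rule sum.mono_neutral_left) (use assms in \<open>auto simp: in_keys_iff\<close>)

lemma linearize_0 [simp]: "linearize y 0 = 0"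
  by (simp add: linearize_def)

lemma linearize_add: "linearize y (p + q) = linearize y p + linearize y q"
proof -
  let ?M = "Poly_Mapping.keys p \<union> Poly_Mapping.keys q"
  have "Poly_Mapping.keys (p + q) \<subseteq> ?M" by (rule Poly_Mapping.keys_add)
  then show ?thesis
    by (simp add: linearize_superset[of ?M] lookup_add distrib_right sum.distrib)
qed

lemma linearize_diff: "linearize y (p - q) = linearize y p - linearize y q"
  using linearize_add[of y "p - q" q] by simp

lemma linearize_sum: "linearize y (\<Sum>i\<in>A. f i) = (\<Sum>i\<in>A. linearize y (f i))"
  by (induction A rule: infinite_finite_induct) (simp_all add: linearize_add)

lemma linearize_single:
  "linearize y (Poly_Mapping.single m c) = c * y (Poly_Mapping.keys m)"
  by (simp add: linearize_def)

lemma linearize_sa_polynomial_empty: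
  "linearize y (sa_polynomial a b {} {}) = a \<bullet> (\<chi> i. y {i}) - b * y {}"
  by (simp add: sa_polynomial_def linearize_diff linearize_sum const_def var_def mult_single
      linearize_single inner_vec_def)

lemma sherali_adams_0:
  fixes A :: "((real ^ 'n) \<times> real) set"
  shows "sherali_adams 0 A = solutions A"
proof (intro equalityI subsetI)
  fix x assume "x \<in> sherali_adams 0 A"
  then obtain y where y: "y \<in> sa_lifted 0 A" "x = (\<chi> i. y {i})"
    by (auto simp: sherali_adams_def)
  have "a \<bullet> x - b \<ge> 0" if "(a, b) \<in> A" for a b
  proof -
    have "linearize y (sa_polynomial a b {} {}) \<ge> 0" "y {} = 1"
      using y(1) that by (fastforce simp: sa_lifted_def)+
    then show ?thesis by (simp add: linearize_sa_polynomial_empty y(2))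
  qed
  then show "x \<in> solutions A" by (auto simp: solutions_def)
next
  fix x assume x: "x \<in> solutions A"
  define y where "y K = (if K = {} then 1 else x $ (THE i. K = {i}))" for K
  have yx: "(\<chi> i. y {i}) = x" by (simp add: y_def vec_eq_iff)
  have "linearize y (sa_polynomial a b I J) \<ge> 0"
    if "(a, b) \<in> A" "card I + card J \<le> 0" for a b I J
  proof -
    have "I = {}" "J = {}" using that(2) by auto
    moreover have "a \<bullet> x - b \<ge> 0" using x that(1) by (auto simp: solutions_def)
    moreover have "y {} = 1" by (simp add: y_def)
    ultimately show ?thesis by (simp add: linearize_sa_polynomial_empty yx)
  qed
  then have "y \<in> sa_lifted 0 A"
    by (auto simp: sa_lifted_def y_def)
  then show "x \<in> sherali_adams 0 A"
    unfolding sherali_adams_def using yx by (metis (no_types, lifting) image_eqI)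
qed

lemma describes_no_good_polytope:
  fixes S :: "(real ^ 'n) set"
  assumes S: "S \<subseteq> zero_one_points"
  shows "describes
    (bound_inequalities \<union> (\<lambda>s. (\<chi> j. if s $ j = 0 then 1 else - 1, 1 / 2 - l1_norm s)) ` S)
    (no_good_polytope S)"
proof -
  let ?V = "(\<lambda>K. \<chi> i. if i \<in> K then 1 else 0) ` (UNIV :: 'n set set) :: (real ^ 'n) set"
  have "x \<in> ?V" if "x \<in> zero_one_points" for x :: "real ^ 'n"
    using that by (intro image_eqI[of _ _ "{i. x $ i = 1}"])
      (auto simp: zero_one_points_def vec_eq_iff)
  then have "S \<subseteq> ?V" using S by blast
  then have fin: "finite S" by (rule finite_subset) simp
  have eq: "(\<chi> j. if s $ j = 0 then 1 else - 1) \<bullet> x - (1 / 2 - l1_norm s) \<ge> 0 \<longleftrightarrow>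
      (\<Sum>j\<in>{j. s $ j = 0}. x $ j) + (\<Sum>j\<in>{j. s $ j = 1}. 1 - x $ j) \<ge> 1 / 2"
    if "s \<in> S" for s x :: "real ^ 'n"
  proof -
    have s: "s $ j = 0 \<or> s $ j = 1" for j using S that by (auto simp: zero_one_points_def)
    have "(\<Sum>j\<in>{j. s $ j = 0}. x $ j) + (\<Sum>j\<in>{j. s $ j = 1}. 1 - x $ j)
        = (\<Sum>j\<in>UNIV. if s $ j = 0 then x $ j else 0) + (\<Sum>j\<in>UNIV. if s $ j = 1 then 1 - x $ j else 0)"
      by (simp add: sum.If_cases)
    also have "\<dots> = (\<Sum>j\<in>UNIV. (if s $ j = 0 then 1 else - 1) * x $ j + \<bar>s $ j\<bar>)"
      unfolding sum.distrib[symmetric] using s by (intro sum.cong) force+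
    also have "\<dots> = (\<chi> j. if s $ j = 0 then 1 else - 1) \<bullet> x + l1_norm s"
      by (simp add: sum.distrib inner_vec_def l1_norm_def)
    finally show ?thesis by linarith
  qed
  have "solutions bound_inequalities = {x :: real ^ 'n. \<forall>i. 0 \<le> x $ i \<and> x $ i \<le> 1}"
    by (auto simp: solutions_def bound_inequalities_def inner_axis')
  moreover have "solutions (A \<union> B) = solutions A \<inter> solutions B"
    for A B :: "((real ^ 'n) \<times> real) set"
    by (auto simp: solutions_def)
  moreover have "finite (bound_inequalities :: ((real ^ 'n) \<times> real) set)"
    by (simp add: bound_inequalities_def)
  ultimately show ?thesis
    using fin eq by (auto simp: describes_def no_good_polytope_def solutions_def)
qed

end

theory Submission
  imports Defs
begin

text \<open>
  The left-hand side of the no-good constraint of \<open>s\<close> is the Hamming distance to \<open>s\<close>, extended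
  affinely from the vertices of the cube to all of space; it is called the slack. Hence the
  constraint \<open>slack s x \<ge> 1 / 2\<close> removes the vertex \<open>s\<close> and no other vertex, and \<open>slack s x \<ge> 1\<close>
  holds on the integer hull.

  A small tree exists because a face of the cube that avoids \<open>S\<close> needs no further branching:
  each of its points has a coordinate opposite to \<open>s\<close>, for every \<open>s \<in> S\<close>, so the no-good
  constraints cut off none of the face, and the face is the hull of its vertices. The tree
  therefore branches only on faces that meet \<open>S\<close>. Each \<open>s \<in> S\<close> lies on at most one face per depth,
  so there are at most \<open>n |S|\<close> internal nodes and at most \<open>2 n |S| + 1 \<le> 3 n |S|\<close> nodes.

  Both hierarchies are defeated by a single point. Let \<open>z \<in> S\<close> have all its neighbours outside
  \<open>S\<close>, and let \<open>c\<^sub>D\<close> be the average of \<open>z\<close> and its neighbours in the directions of \<open>D\<close>. Its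
  slack at \<open>z\<close> is \<open>|D| / (|D| + 1) < 1\<close>, so it is never in the integer hull, but for
  \<open>|D| = n\<close> it survives \<open>n - 1\<close> rounds:

  \<^item> For lift-and-project, \<open>c\<^sub>D\<close> lies on the segment from the neighbour in direction \<open>i \<in> D\<close>,
    which is a feasible vertex, to the centroid of \<open>D - {i}\<close>. So a round of lift-and-project
    costs at most one direction, and one remaining direction suffices for the polytope
    itself, since the midpoints of the edges at \<open>z\<close> have slack exactly \<open>1 / 2\<close> with respect to \<open>z\<close>
    (\<open>corner_centroid_in_lift_project_iter\<close>).

  \<^item> For Sherali-Adams, the lifted point consists of the moments of the uniform distribution on
    \<open>z\<close> and its neighbours. A product with fewer than \<open>n\<close> factors restricts this distribution to
    a face of positive dimension, and if this face contains the infeasible vertex \<open>z\<close>, then it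
    also contains a neighbour of \<open>z\<close>. The two together contribute a positive multiple of the
    value at their midpoint, which is feasible
    (\<open>corner_centroid_in_sherali_adams\<close>).
\<close>

section \<open>The slack of a no-good constraint\<close>

text \<open>For a vertex \<open>s\<close> of the cube, a summand is \<open>x $ j\<close> if \<open>s $ j = 0\<close> and \<open>1 - x $ j\<close> if
  \<open>s $ j = 1\<close>. In this form the slack is visibly affine in \<open>x\<close>.\<close>

definition slack :: "real ^ 'n \<Rightarrow> real ^ 'n \<Rightarrow> real" where
  "slack s x = (\<Sum>j\<in>UNIV. s $ j + (1 - 2 * s $ j) * x $ j)"

definition flip :: "real ^ 'n \<Rightarrow> 'n \<Rightarrow> real ^ 'n" where
  "flip z i = (\<chi> j. if j = i then 1 - z $ j else z $ j)"

lemma zero_one_pointsD: "x \<in> zero_one_points \<Longrightarrow> x $ i = 0 \<or> x $ i = 1"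
  by (simp add: zero_one_points_def)

lemma flip_zero_one_points: "z \<in> zero_one_points \<Longrightarrow> flip z i \<in> zero_one_points"
  by (auto simp: zero_one_points_def flip_def)

lemma finite_zero_one_points: "finite (zero_one_points :: (real ^ 'n) set)"
proof (rule finite_subset)
  show "zero_one_points \<subseteq> range (\<lambda>K. \<chi> i :: 'n. (if i \<in> K then 1 else 0 :: real))"
  proof
    fix x :: "real ^ 'n" assume "x \<in> zero_one_points"
    then show "x \<in> range (\<lambda>K. \<chi> i. if i \<in> K then 1 else 0)"
      by (intro image_eqI[of _ _ "{i. x $ i = 1}"]) (auto simp: zero_one_points_def vec_eq_iff)
  qed
qed simp

lemma slack_eq_inner: "slack s x = (\<Sum>j\<in>UNIV. s $ j) + (\<chi> j. 1 - 2 * s $ j) \<bullet> x"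
  by (simp add: slack_def sum.distrib inner_vec_def)

lemma slack_eq_no_good:
  assumes "s \<in> zero_one_points"
  shows "slack s x = (\<Sum>j\<in>{j. s $ j = 0}. x $ j) + (\<Sum>j\<in>{j. s $ j = 1}. 1 - x $ j)"
proof -
  have "(\<Sum>j\<in>{j. s $ j = 0}. x $ j) + (\<Sum>j\<in>{j. s $ j = 1}. 1 - x $ j)
      = (\<Sum>j\<in>UNIV. if s $ j = 0 then x $ j else 0) + (\<Sum>j\<in>UNIV. if s $ j = 1 then 1 - x $ j else 0)"
    by (simp add: sum.If_cases)
  also have "\<dots> = slack s x"
    unfolding sum.distrib[symmetric] slack_def
  proof (intro sum.cong refl)
    fix j
    show "(if s $ j = 0 then x $ j else 0) + (if s $ j = 1 then 1 - x $ j else 0)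
        = s $ j + (1 - 2 * s $ j) * x $ j"
      using zero_one_pointsD[OF assms, of j] by auto
  qed
  finally show ?thesis by simp
qed

lemma mem_no_good_polytope_iff:
  assumes "S \<subseteq> zero_one_points"
  shows "x \<in> no_good_polytope S \<longleftrightarrow>
    (\<forall>i. 0 \<le> x $ i \<and> x $ i \<le> 1) \<and> (\<forall>s\<in>S. slack s x \<ge> 1 / 2)"
  using assms by (auto simp: no_good_polytope_def slack_eq_no_good subset_iff)

lemma slack_convex_combination:
  assumes "u + v = 1"
  shows "slack s (u *\<^sub>R x + v *\<^sub>R y) = u * slack s x + v * slack s y"
proof -
  have v: "v = 1 - u" using assms by simp
  show ?thesis unfolding v by (simp add: slack_eq_inner inner_add_right algebra_simps)
qed

lemma convex_slack_ge: "convex {x. slack s x \<ge> c}"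
proof -
  have "{x. slack s x \<ge> c} = {x. (\<chi> j. 1 - 2 * s $ j) \<bullet> x \<ge> c - (\<Sum>j\<in>UNIV. s $ j)}"
    by (auto simp: slack_eq_inner)
  then show ?thesis by (simp add: convex_halfspace_ge)
qed

lemma convex_no_good_polytope:
  assumes "S \<subseteq> zero_one_points"
  shows "convex (no_good_polytope S)"
proof -
  have "no_good_polytope S = cbox 0 1 \<inter> (\<Inter>s\<in>S. {x. slack s x \<ge> 1 / 2})"
    using assms by (auto simp: mem_no_good_polytope_iff mem_box_cart)
  also have "convex \<dots>"
    by (intro convex_Int convex_box convex_INT convex_slack_ge)
  finally show ?thesis .
qed

lemma slack_self: "s \<in> zero_one_points \<Longrightarrow> slack s s = 0"
  unfolding slack_def
proof (intro sum.neutral ballI)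
  fix j assume "s \<in> zero_one_points"
  then show "s $ j + (1 - 2 * s $ j) * s $ j = 0"
    using zero_one_pointsD[of s j] by auto
qed

text \<open>The coordinate in which \<open>x\<close> and \<open>s\<close> differ contributes 1, and no coordinate
  contributes a negative amount.\<close>

lemma slack_ge_1:
  assumes s: "s \<in> zero_one_points" and x: "x \<in> zero_one_points" and "x \<noteq> s"
  shows "slack s x \<ge> 1"
proof -
  obtain j where "x $ j \<noteq> s $ j" using \<open>x \<noteq> s\<close> by (auto simp: vec_eq_iff)
  then have "1 = s $ j + (1 - 2 * s $ j) * x $ j"
    using zero_one_pointsD[OF s, of j] zero_one_pointsD[OF x, of j] by auto
  also have "\<dots> \<le> slack s x"
    unfolding slack_def
  proof (rule member_le_sum)
    fix i
    show "0 \<le> s $ i + (1 - 2 * s $ i) * x $ i"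
      using zero_one_pointsD[OF s, of i] zero_one_pointsD[OF x, of i] by auto
  qed auto
  finally show ?thesis .
qed

lemma slack_flip:
  assumes "z \<in> zero_one_points"
  shows "slack z (flip z i) = 1"
proof -
  have "slack z (flip z i) = (\<Sum>j\<in>UNIV. if j = i then 1 else 0)"
    unfolding slack_def
  proof (intro sum.cong refl)
    fix j
    show "z $ j + (1 - 2 * z $ j) * flip z i $ j = (if j = i then 1 else 0)"
      using zero_one_pointsD[OF assms, of j] by (auto simp: flip_def)
  qed
  then show ?thesis by simp
qed

lemma l1_norm_flip:
  assumes "z \<in> zero_one_points"
  shows "l1_norm (flip z i - z) = 1"
proof -
  have "l1_norm (flip z i - z) = (\<Sum>j\<in>UNIV. if j = i then 1 else 0)"
    unfolding l1_norm_def
  proof (intro sum.cong refl)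
    fix j
    show "\<bar>(flip z i - z) $ j\<bar> = (if j = i then 1 else 0)"
      using zero_one_pointsD[OF assms, of j] by (auto simp: flip_def)
  qed
  then show ?thesis by simp
qed

lemma zero_one_in_no_good_polytope_iff:
  assumes "S \<subseteq> zero_one_points" "x \<in> zero_one_points"
  shows "x \<in> no_good_polytope S \<longleftrightarrow> x \<notin> S"
proof
  assume "x \<in> no_good_polytope S"
  then show "x \<notin> S"
    using assms slack_self[of x] by (auto simp: mem_no_good_polytope_iff)
next
  assume "x \<notin> S"
  have "slack s x \<ge> 1 / 2" if "s \<in> S" for s
    using slack_ge_1[of s x] that assms \<open>x \<notin> S\<close> by force
  moreover have "0 \<le> x $ i \<and> x $ i \<le> 1" for i
    using zero_one_pointsD[OF assms(2), of i] by auto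
  ultimately show "x \<in> no_good_polytope S"
    using assms by (simp add: mem_no_good_polytope_iff)
qed

lemma slack_ge_1_on_integer_hull:
  assumes S: "S \<subseteq> zero_one_points" and "s \<in> S" and x: "x \<in> integer_hull (no_good_polytope S)"
  shows "slack s x \<ge> 1"
proof -
  have "no_good_polytope S \<inter> zero_one_points \<subseteq> {x. slack s x \<ge> 1}"
    using S \<open>s \<in> S\<close> by (auto simp: zero_one_in_no_good_polytope_iff intro!: slack_ge_1)
  then have "integer_hull (no_good_polytope S) \<subseteq> {x. slack s x \<ge> 1}"
    unfolding integer_hull_def by (rule hull_minimal) (rule convex_slack_ge)
  then show ?thesis using x by auto
qed

section \<open>The branch-and-bound tree\<close>

text \<open>The list fixes one branching order for all nodes. The set consists of the excluded vertices
  that lie on the face of the current node; once none is left, the node becomes a leaf.\<close>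

fun no_good_tree :: "'n list \<Rightarrow> (real ^ 'n) set \<Rightarrow> 'n bb_tree" where
  "no_good_tree [] S = Leaf"
| "no_good_tree (j # js) S = (if S = {} then Leaf
     else Branch j (no_good_tree js {s \<in> S. s $ j = 0}) (no_good_tree js {s \<in> S. s $ j = 1}))"

text \<open>The two children of a node split its excluded vertices between them, so the bound for the
  subtrees adds up to \<open>2 * (length js - 1) * card S + 2\<close>. The node itself adds 1, and passing
  to the full length leaves room for \<open>2 * card S \<ge> 2\<close> more.\<close>

lemma num_nodes_no_good_tree:
  assumes "S \<subseteq> zero_one_points"
  shows "num_nodes (no_good_tree js S) \<le> 2 * length js * card S + 1"
  using assms
proof (induction js arbitrary: S)
  case (Cons j js)
  let ?S = "\<lambda>c. {s \<in> S. s $ j = c}"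
  have fin: "finite S" using Cons.prems finite_zero_one_points by (rule finite_subset)
  have "S = ?S 0 \<union> ?S 1" using Cons.prems by (auto dest: zero_one_pointsD)
  moreover have "card (?S 0 \<union> ?S 1) = card (?S 0) + card (?S 1)"
    using fin by (intro card_Un_disjoint) auto
  ultimately have card: "card S = card (?S 0) + card (?S 1)" by simp
  have IH: "num_nodes (no_good_tree js (?S c)) \<le> 2 * length js * card (?S c) + 1" for c
    using Cons.prems by (intro Cons.IH) auto
  show ?case
  proof (cases "S = {}")
    case False
    then have "card S \<ge> 1" using fin by (simp add: Suc_leI card_gt_0_iff)
    have "num_nodes (no_good_tree (j # js) S) \<le> 2 * length js * card S + 3"
      using False IH[of 0] IH[of 1] by (simp add: card algebra_simps)
    also have "\<dots> \<le> 2 * length (j # js) * card S + 1"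
      using \<open>card S \<ge> 1\<close> by simp
    finally show ?thesis .
  qed simp
qed simp

lemma admissible_no_good_tree:
  "distinct js \<Longrightarrow> set js \<inter> fst ` C = {} \<Longrightarrow> admissible_below C (no_good_tree js S)"
  by (induction js arbitrary: C S) auto

definition satisfies :: "('n \<times> real) set \<Rightarrow> real ^ 'n \<Rightarrow> bool" where
  "satisfies C x \<longleftrightarrow> (\<forall>(j, c)\<in>C. x $ j = c)"

lemma satisfies_insert: "satisfies (insert (j, c) C) x \<longleftrightarrow> x $ j = c \<and> satisfies C x"
  by (auto simp: satisfies_def)

lemma mem_atom_iff: "x \<in> atom P C \<longleftrightarrow> x \<in> P \<and> satisfies C x"
  by (auto simp: atom_def satisfies_def)

text \<open>Branching stops for one of two reasons: no variable is left, or no excluded vertex lies on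
  the face. Either reason makes the atom integral.\<close>

lemma leaf_of_no_good_tree:
  assumes "C' \<in> leaf_constraints_below C (no_good_tree js {s \<in> S. satisfies C s})"
    and "snd ` C \<subseteq> {0, 1}" and "fst ` C \<union> set js = UNIV"
  shows "snd ` C' \<subseteq> {0, 1} \<and> (fst ` C' = UNIV \<or> {s \<in> S. satisfies C' s} = {})"
  using assms
proof (induction js arbitrary: C)
  case (Cons j js)
  let ?S = "{s \<in> S. satisfies C s}"
  have "{s \<in> ?S. s $ j = c} = {s \<in> S. satisfies (insert (j, c) C) s}" for c
    by (auto simp: satisfies_insert)
  then have split: "C' \<in> leaf_constraints_below C (no_good_tree (j # js) ?S) \<longleftrightarrow>
      (if ?S = {} then C' = C else
        (\<exists>c\<in>{0, 1}. C' \<in> leaf_constraints_below (insert (j, c) C)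
            (no_good_tree js {s \<in> S. satisfies (insert (j, c) C) s})))"
    by auto
  show ?case
  proof (cases "?S = {}")
    case True
    then show ?thesis using Cons.prems split by simp
  next
    case False
    obtain c where "c \<in> {0, 1}" and "C' \<in> leaf_constraints_below (insert (j, c) C)
            (no_good_tree js {s \<in> S. satisfies (insert (j, c) C) s})"
      using Cons.prems(1) unfolding split if_not_P[OF False] by blast
    then show ?thesis using Cons.prems(2,3) by (intro Cons.IH[of "insert (j, c) C"]) auto
  qed
qed simp

lemma zero_one_point_satisfies_some_leaf:
  assumes "x \<in> zero_one_points" "satisfies C x"
  shows "\<exists>C'\<in>leaf_constraints_below C T. satisfies C' x"
  using assms
proof (induction T arbitrary: C)
  case (Branch j l r)
  have "x $ j = 0 \<or> x $ j = 1" using Branch.prems by (simp add: zero_one_pointsD)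
  then show ?case
    using Branch.IH(1)[OF Branch.prems(1), of "insert (j, 0) C"]
      Branch.IH(2)[OF Branch.prems(1), of "insert (j, 1) C"] Branch.prems(2)
    by (auto simp: satisfies_insert)
qed simp

text \<open>This is the integrality of a face of the cube, in a form that keeps track of the face: any
  coordinate constraint with value 0 or 1 that holds at \<open>x\<close> also holds at the vertices used.
  A fractional coordinate \<open>x $ i\<close> is removed by writing \<open>x\<close> as the average of its two
  roundings in direction \<open>i\<close> with weights \<open>1 - x $ i\<close> and \<open>x $ i\<close>.\<close>

lemma cube_point_in_hull_of_roundings:
  fixes x :: "real ^ 'n"
  assumes "\<And>i. 0 \<le> x $ i \<and> x $ i \<le> 1"
  shows "x \<in> convex hull {w \<in> zero_one_points. \<forall>j. x $ j \<in> {0, 1} \<longrightarrow> w $ j = x $ j}"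
  using assms
proof (induction "card {i. x $ i \<notin> {0, 1}}" arbitrary: x rule: less_induct)
  case less
  let ?W = "\<lambda>x. {w \<in> zero_one_points. \<forall>j. x $ j \<in> {0, 1} \<longrightarrow> w $ j = x $ j}"
  show ?case
  proof (cases "x \<in> zero_one_points")
    case True
    then show ?thesis by (intro hull_inc) auto
  next
    case False
    then obtain i where i: "x $ i \<notin> {0, 1}" by (auto simp: zero_one_points_def)
    define r where "r c = (\<chi> j. if j = i then c else x $ j)" for c
    have r_in: "r c \<in> convex hull ?W x" if c: "c \<in> {0, 1}" for c
    proof -
      have "{j. r c $ j \<notin> {0, 1}} \<subset> {j. x $ j \<notin> {0, 1}}"
        using c i by (auto simp: r_def)
      then have "card {j. r c $ j \<notin> {0, 1}} < card {j. x $ j \<notin> {0, 1}}"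
        by (intro psubset_card_mono) auto
      moreover have "0 \<le> r c $ j \<and> r c $ j \<le> 1" for j
        using c less.prems[of j] by (auto simp: r_def)
      ultimately have "r c \<in> convex hull ?W (r c)" by (rule less.hyps)
      moreover have "?W (r c) \<subseteq> ?W x"
      proof
        fix w assume w: "w \<in> ?W (r c)"
        have "w $ j = x $ j" if "x $ j \<in> {0, 1}" for j
        proof -
          have "j \<noteq> i" using that i by auto
          then have "r c $ j = x $ j" by (simp add: r_def)
          then show ?thesis using w that by force
        qed
        then show "w \<in> ?W x" using w by blast
      qed
      ultimately show ?thesis using hull_mono by blast
    qed
    have "(1 - x $ i) *\<^sub>R r 0 + (x $ i) *\<^sub>R r 1 \<in> convex hull ?W x"
      using less.prems[of i] by (intro convexD[OF convex_convex_hull] r_in) auto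
    also have "(1 - x $ i) *\<^sub>R r 0 + (x $ i) *\<^sub>R r 1 = x"
      by (auto simp: vec_eq_iff r_def algebra_simps)
    finally show ?thesis .
  qed
qed

text \<open>One inclusion holds for every tree, because a vertex of the cube follows a path from the
  root to a leaf. For the other, the atoms of the leaves are integral: such an atom is a single
  vertex or empty if all variables are fixed, and an entire face of the cube otherwise.\<close>

lemma tree_hull_no_good_tree:
  fixes S :: "(real ^ 'n) set"
  assumes S: "S \<subseteq> zero_one_points" and js: "set js = UNIV"
  shows "tree_hull (no_good_tree js S) (no_good_polytope S) = integer_hull (no_good_polytope S)"
    (is "tree_hull ?T ?P = _")
proof
  show "integer_hull ?P \<subseteq> tree_hull ?T ?P"
    unfolding integer_hull_def tree_hull_def leaf_constraints_def
  proof (intro hull_mono subsetI)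
    fix x assume "x \<in> ?P \<inter> zero_one_points"
    then show "x \<in> (\<Union>C\<in>leaf_constraints_below {} ?T. atom ?P C)"
      using zero_one_point_satisfies_some_leaf[of x "{}" ?T]
      by (auto simp: mem_atom_iff satisfies_def)
  qed
next
  have "atom ?P C \<subseteq> integer_hull ?P" if "C \<in> leaf_constraints_below {} ?T" for C
  proof
    fix x assume "x \<in> atom ?P C"
    then have x: "x \<in> ?P" "satisfies C x" by (auto simp: mem_atom_iff)
    have "{s \<in> S. satisfies {} s} = S" by (simp add: satisfies_def)
    then have C: "snd ` C \<subseteq> {0, 1}" "fst ` C = UNIV \<or> {s \<in> S. satisfies C s} = {}"
      using leaf_of_no_good_tree[of C "{}" js S] that js by auto
    have fixed: "x $ j \<in> {0, 1}" if "(j, c) \<in> C" for j c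
      using x(2) C(1) that by (force simp: satisfies_def)
    from C(2) show "x \<in> integer_hull ?P"
    proof
      assume "fst ` C = UNIV"
      then have "x \<in> zero_one_points"
        using fixed unfolding zero_one_points_def by force
      then show ?thesis using x(1) by (simp add: integer_hull_def hull_inc)
    next
      assume none: "{s \<in> S. satisfies C s} = {}"
      let ?W = "{w \<in> zero_one_points. \<forall>j. x $ j \<in> {0, 1} \<longrightarrow> w $ j = x $ j}"
      have "?W \<subseteq> ?P \<inter> zero_one_points"
      proof
        fix w assume w: "w \<in> ?W"
        then have "satisfies C w" using x(2) fixed by (fastforce simp: satisfies_def)
        then have "w \<notin> S" using none by blast
        then show "w \<in> ?P \<inter> zero_one_points"
          using w S by (simp add: zero_one_in_no_good_polytope_iff)
      qed
      moreover have "x \<in> convex hull ?W"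
        using x(1) by (intro cube_point_in_hull_of_roundings) (simp add: no_good_polytope_def)
      ultimately show ?thesis unfolding integer_hull_def using hull_mono by blast
    qed
  qed
  then show "tree_hull ?T ?P \<subseteq> integer_hull ?P"
    unfolding tree_hull_def leaf_constraints_def
    by (intro hull_minimal) (auto simp: integer_hull_def)
qed

section \<open>The centroid at an isolated excluded vertex\<close>

definition corner_centroid :: "real ^ 'n \<Rightarrow> 'n set \<Rightarrow> real ^ 'n" where
  "corner_centroid z D = (1 / (real (card D) + 1)) *\<^sub>R (z + (\<Sum>i\<in>D. flip z i))"

text \<open>This decomposition drives the lift-and-project induction: if \<open>z\<close> is a vertex, \<open>x\<^sub>i\<close> takes opposite
  values from \<open>{0, 1}\<close> at the two end points, since the centroid of \<open>D - {i}\<close> agrees with \<open>z\<close>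
  in coordinate \<open>i\<close>.\<close>

lemma corner_centroid_remove:
  assumes "i \<in> D"
  shows "corner_centroid z D =
    (1 / (real (card D) + 1)) *\<^sub>R flip z i
      + (real (card D) / (real (card D) + 1)) *\<^sub>R corner_centroid z (D - {i})"
proof -
  have "finite D" by simp
  have d: "real (card (D - {i})) + 1 = real (card D)"
    using card_Suc_Diff1[OF \<open>finite D\<close> assms] by linarith
  have "card D \<noteq> 0" using assms by auto
  then show ?thesis
    unfolding corner_centroid_def d
    using sum.remove[OF \<open>finite D\<close> assms, of "flip z"]
    by (simp add: scaleR_add_right)
qed

lemma corner_centroid_notin:
  assumes "i \<notin> D"
  shows "corner_centroid z D $ i = z $ i"
proof -
  have "(\<Sum>k\<in>D. flip z k $ i) = (\<Sum>k\<in>D. z $ i)"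
    using assms by (intro sum.cong) (auto simp: flip_def)
  then have "z $ i + (\<Sum>k\<in>D. flip z k $ i) = (real (card D) + 1) * z $ i"
    by (simp add: algebra_simps)
  then show ?thesis
    by (simp add: corner_centroid_def add_pos_nonneg)
qed

lemma slack_corner_centroid:
  assumes "z \<in> zero_one_points"
  shows "slack z (corner_centroid z D) = real (card D) / (real (card D) + 1)"
proof -
  define g c where "g = (\<chi> j. 1 - 2 * z $ j)" and "c = (\<Sum>j\<in>UNIV. z $ j)"
  have slack: "slack z x = c + g \<bullet> x" for x by (simp add: g_def c_def slack_eq_inner)
  have g: "g \<bullet> z = - c" "g \<bullet> flip z i = 1 - c" for i
    using slack_self[OF assms] slack_flip[OF assms, of i] by (simp_all add: slack)
  show ?thesis
    unfolding slack corner_centroid_def inner_scaleR_right inner_add_right inner_sum_right g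
    by (simp add: field_simps)
qed

lemma corner_centroid_notin_integer_hull:
  assumes "S \<subseteq> zero_one_points" "z \<in> S"
  shows "corner_centroid z D \<notin> integer_hull (no_good_polytope S)"
proof
  assume "corner_centroid z D \<in> integer_hull (no_good_polytope S)"
  then have "slack z (corner_centroid z D) \<ge> 1"
    using assms by (intro slack_ge_1_on_integer_hull)
  then show False
    using assms by (auto simp: slack_corner_centroid subset_iff field_simps)
qed

lemma flip_in_no_good_polytope:
  assumes "S \<subseteq> zero_one_points" "z \<in> S" "flip z i \<notin> S"
  shows "flip z i \<in> no_good_polytope S"
  using assms flip_zero_one_points[of z i]
  by (simp add: zero_one_in_no_good_polytope_iff subset_iff)

text \<open>The constant \<open>1 / 2\<close> in the no-good constraints matters here: the slack at \<open>z\<close> is 0 at one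
  end of the edge and 1 at the other. For the remaining \<open>s \<in> S\<close>, both ends are vertices
  different from \<open>s\<close>.\<close>

lemma edge_midpoint_in_no_good_polytope:
  assumes S: "S \<subseteq> zero_one_points" and z: "z \<in> S" and i: "flip z i \<notin> S"
  shows "(1 / 2) *\<^sub>R z + (1 / 2) *\<^sub>R flip z i \<in> no_good_polytope S" (is "?m \<in> _")
proof -
  have z01: "z \<in> zero_one_points" using S z by auto
  have "slack s ?m \<ge> 1 / 2" if "s \<in> S" for s
  proof -
    have s01: "s \<in> zero_one_points" using S that by auto
    have "slack s (flip z i) \<ge> 1"
      using slack_ge_1[OF s01 flip_zero_one_points[OF z01]] i that by metis
    moreover have "slack s z \<ge> 0"
      using slack_ge_1[OF s01 z01] slack_self[OF z01] by (cases "z = s") auto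
    ultimately show ?thesis by (simp add: slack_convex_combination)
  qed
  moreover have "0 \<le> ?m $ j \<and> ?m $ j \<le> 1" for j
    using zero_one_pointsD[OF z01, of j] by (auto simp: flip_def)
  ultimately show ?thesis using S by (simp add: mem_no_good_polytope_iff)
qed

section \<open>Lift-and-project\<close>

lemma lift_projectI:
  assumes "\<And>i. x \<in> convex hull ((P \<inter> {x. x $ i = 0}) \<union> (P \<inter> {x. x $ i = 1}))"
  shows "x \<in> lift_project P"
  using assms by (simp add: lift_project_def)

lemma zero_one_in_lift_project_iter:
  assumes "x \<in> zero_one_points" "x \<in> P"
  shows "x \<in> lift_project_iter k P"
proof (induction k)
  case (Suc k)
  have "x \<in> lift_project (lift_project_iter k P)"
    using Suc zero_one_pointsD[OF assms(1)] by (intro lift_projectI hull_inc) auto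
  then show ?case by simp
qed (simp add: assms)

text \<open>In the induction step, a direction outside \<open>D\<close> is harmless because the centroid already has
  an integral coordinate there. A direction in \<open>D\<close> is handled by splitting off the neighbour of
  \<open>z\<close> in that direction, which leaves a centroid with one direction less and uses up the round.
  The hypothesis \<open>k < card D\<close> keeps at least one direction for \<open>k = 0\<close>.\<close>

lemma corner_centroid_in_lift_project_iter:
  assumes S: "S \<subseteq> zero_one_points" and z: "z \<in> S" and isolated: "\<And>i. flip z i \<notin> S"
    and "k < card D"
  shows "corner_centroid z D \<in> lift_project_iter k (no_good_polytope S)"
  using \<open>k < card D\<close>
proof (induction k arbitrary: D)
  case 0
  have "finite D" "D \<noteq> {}" using 0 by auto
  then show ?case
  proof (induction D rule: finite_ne_induct)
    case (singleton i)
    then show ?case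
      using edge_midpoint_in_no_good_polytope[OF S z isolated[of i]]
      by (simp add: corner_centroid_def scaleR_add_right)
  next
    case (insert i D)
    have "corner_centroid z (insert i D) = (1 / (real (card (insert i D)) + 1)) *\<^sub>R flip z i
      + (real (card (insert i D)) / (real (card (insert i D)) + 1)) *\<^sub>R corner_centroid z D"
      using corner_centroid_remove[of i "insert i D" z] insert.hyps by simp
    also have "\<dots> \<in> no_good_polytope S"
      using insert.IH flip_in_no_good_polytope[OF S z isolated[of i]]
      by (intro convexD[OF convex_no_good_polytope[OF S]]) (auto simp: field_simps)
    finally show ?case by simp
  qed
next
  case (Suc k)
  let ?L = "lift_project_iter k (no_good_polytope S)"
  have z01: "z \<in> zero_one_points" using S z by auto
  have "corner_centroid z D \<in> lift_project ?L"
  proof (rule lift_projectI)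
    fix i
    let ?U = "(?L \<inter> {x. x $ i = 0}) \<union> (?L \<inter> {x. x $ i = 1})"
    have in_U: "corner_centroid z E \<in> convex hull ?U" if "i \<notin> E" "k < card E" for E
      using Suc.IH[OF that(2)] corner_centroid_notin[OF that(1), of z] zero_one_pointsD[OF z01, of i]
      by (intro hull_inc) auto
    show "corner_centroid z D \<in> convex hull ?U"
    proof (cases "i \<in> D")
      case False
      then show ?thesis using Suc.prems by (intro in_U) auto
    next
      case True
      have "flip z i \<in> ?L"
        by (intro zero_one_in_lift_project_iter flip_zero_one_points z01
            flip_in_no_good_polytope S z isolated)
      then have "flip z i \<in> convex hull ?U"
        using zero_one_pointsD[OF flip_zero_one_points[OF z01], of i i] by (intro hull_inc) auto
      moreover have "corner_centroid z (D - {i}) \<in> convex hull ?U"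
        using Suc.prems True by (intro in_U) (auto simp: card_Diff_singleton)
      ultimately show ?thesis
        unfolding corner_centroid_remove[OF True]
        by (intro convexD[OF convex_convex_hull]) (auto simp: field_simps)
    qed
  qed
  then show ?case by simp
qed

section \<open>Sherali-Adams\<close>

text \<open>These are the values at \<open>v\<close> of the multilinear monomials, so linearizing a polynomial with
  them amounts to evaluating it at \<open>v\<close> when \<open>v\<close> is a vertex of the cube.\<close>

definition vertex_moments :: "real ^ 'n \<Rightarrow> 'n set \<Rightarrow> real" where
  "vertex_moments v K = (\<Prod>i\<in>K. v $ i)"

text \<open>Repeated factors from \<open>K \<inter> L\<close> do no harm because coordinates of vertices are idempotent.
  This is what makes the replacement of \<open>x\<^sub>i\<^sup>2\<close> by \<open>x\<^sub>i\<close> compatible with multiplication.\<close>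

lemma vertex_moments_Un:
  fixes v :: "real ^ 'n"
  assumes "v \<in> zero_one_points"
  shows "vertex_moments v (K \<union> L) = vertex_moments v K * vertex_moments v L"
proof -
  have eq: "vertex_moments v K = (if \<forall>i\<in>K. v $ i = 1 then 1 else 0)" for K
    using zero_one_pointsD[OF assms] by (force simp: vertex_moments_def)
  show ?thesis unfolding eq by auto
qed

lemma keys_add_nat:
  fixes m m' :: "'a \<Rightarrow>\<^sub>0 nat"
  shows "Poly_Mapping.keys (m + m') = Poly_Mapping.keys m \<union> Poly_Mapping.keys m'"
  by (auto simp: in_keys_iff lookup_add)

lemma poly_mapping_add_induct [case_names single add]:
  assumes single: "\<And>m c. P (Poly_Mapping.single m c)"
    and add: "\<And>p q. P p \<Longrightarrow> P q \<Longrightarrow> P (p + q)"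
  shows "P p"
proof (induction p rule: update_induct)
  case const
  show ?case using single[of undefined 0] by simp
next
  case (update f a b)
  have "Poly_Mapping.update a b f = f + Poly_Mapping.single a b"
    using update.hyps by (intro poly_mapping_eqI)
      (auto simp: lookup_update lookup_add lookup_single in_keys_iff when_def)
  then show ?case using add[OF update.IH single] by simp
qed

lemma linearize_vertex_mult:
  fixes v :: "real ^ 'n"
  assumes "v \<in> zero_one_points"
  shows "linearize (vertex_moments v) (p * q)
    = linearize (vertex_moments v) p * linearize (vertex_moments v) q"
proof -
  have monomial: "linearize (vertex_moments v) (Poly_Mapping.single m c * q)
      = linearize (vertex_moments v) (Poly_Mapping.single m c) * linearize (vertex_moments v) q" for m c
  proof (induction q rule: poly_mapping_add_induct)
    case (single k c')
    then show ?case
      by (simp add: mult_single linearize_single keys_add_nat vertex_moments_Un[OF assms])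
  next
    case (add p q)
    then show ?case by (simp add: linearize_add ring_distribs)
  qed
  show ?thesis
  proof (induction p rule: poly_mapping_add_induct)
    case (single k c)
    then show ?case by (rule monomial)
  next
    case (add p q)
    then show ?case by (simp add: linearize_add ring_distribs)
  qed
qed

lemma linearize_vertex_var: "linearize (vertex_moments v) (var i) = v $ i"
  by (simp add: var_def linearize_single vertex_moments_def)

lemma linearize_const: "y {} = 1 \<Longrightarrow> linearize y (const c) = c"
  by (simp add: const_def linearize_single)

lemma vertex_moments_empty: "vertex_moments v {} = 1"
  by (simp add: vertex_moments_def)

lemma linearize_vertex_one: "linearize (vertex_moments v) 1 = 1"
  using linearize_const[of "vertex_moments v" 1, OF vertex_moments_empty] by (simp add: const_def)

lemma linearize_vertex_prod:
  fixes v :: "real ^ 'n"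
  assumes "v \<in> zero_one_points"
  shows "linearize (vertex_moments v) (\<Prod>i\<in>I. f i) = (\<Prod>i\<in>I. linearize (vertex_moments v) (f i))"
  by (induction I rule: infinite_finite_induct)
    (simp_all add: linearize_vertex_one linearize_vertex_mult[OF assms])

lemma linearize_vertex_sa_polynomial:
  fixes v :: "real ^ 'n"
  assumes "v \<in> zero_one_points"
  shows "linearize (vertex_moments v) (sa_polynomial a b I J)
    = (a \<bullet> v - b) * ((\<Prod>i\<in>I. v $ i) * (\<Prod>j\<in>J. 1 - v $ j))"
  by (simp add: sa_polynomial_def linearize_vertex_mult[OF assms] linearize_vertex_prod[OF assms]
      linearize_diff linearize_sum linearize_vertex_var linearize_vertex_one
      linearize_const[of "vertex_moments v", OF vertex_moments_empty] inner_vec_def)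

lemma linearize_centroid_moments:
  "linearize (\<lambda>K. c * (y K + (\<Sum>i\<in>D. f i K))) p = c * (linearize y p + (\<Sum>i\<in>D. linearize (f i) p))"
proof -
  have "linearize (\<lambda>K. \<Sum>i\<in>D. f i K) p = (\<Sum>i\<in>D. linearize (f i) p)"
    unfolding linearize_def sum_distrib_left by (rule sum.swap)
  moreover have "linearize (\<lambda>K. c * (y K + g K)) p = c * (linearize y p + linearize g p)" for g
    by (simp add: linearize_def sum_distrib_left sum.distrib[symmetric] algebra_simps)
  ultimately show ?thesis by simp
qed

text \<open>The witness is an average of vertex moments, hence the linearization of a product is the
  average of its values at \<open>z\<close> and its neighbours. Only the value at \<open>z\<close> can be negative, and
  only if no factor vanishes at \<open>z\<close>. As there are fewer than \<open>n\<close> factors, some direction \<open>l\<close>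
  is not mentioned by any of them. The factors do not distinguish \<open>z\<close> from its neighbour in
  direction \<open>l\<close>, so the two values sum to twice the value of the inequality at the midpoint of
  the edge, times the common factor.\<close>

lemma corner_centroid_in_sherali_adams:
  fixes S :: "(real ^ 'n) set"
  assumes S: "S \<subseteq> zero_one_points" and z: "z \<in> S" and isolated: "\<And>i. flip z i \<notin> S"
    and A: "describes A (no_good_polytope S)" and k: "k < CARD('n)"
  shows "corner_centroid z UNIV \<in> sherali_adams k A"
proof -
  let ?c = "1 / (real CARD('n) + 1)"
  define y where "y K = ?c * (vertex_moments z K + (\<Sum>i\<in>UNIV. vertex_moments (flip z i) K))" for K
  have z01: "z \<in> zero_one_points" using S z by auto
  have f01: "flip z i \<in> zero_one_points" for i using z01 by (rule flip_zero_one_points)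
  have valid: "a \<bullet> x - b \<ge> 0" if "(a, b) \<in> A" "x \<in> no_good_polytope S" for a b x
    using A that by (auto simp: describes_def solutions_def)
  have "linearize y (sa_polynomial a b I J) \<ge> 0"
    if ab: "(a, b) \<in> A" and IJ: "I \<inter> J = {}" "card I + card J \<le> k" for a b I J
  proof -
    \<comment> \<open>On vertices this is the indicator of the face \<open>x\<^sub>I = 1, x\<^sub>J = 0\<close>.\<close>
    define ind where "ind v = (\<Prod>i\<in>I. v $ i) * (\<Prod>j\<in>J. 1 - v $ j)" for v :: "real ^ 'n"
    have ind_nonneg: "ind v \<ge> 0" if "v \<in> zero_one_points" for v
      unfolding ind_def using zero_one_pointsD[OF that]
      by (intro mult_nonneg_nonneg prod_nonneg) (metis diff_ge_0_iff_ge order.refl zero_le_one)+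
    have "card (I \<union> J) < CARD('n)" using IJ k by (simp add: card_Un_disjoint)
    then obtain l where l: "l \<notin> I \<union> J" by (metis UNIV_eq_I nat_neq_iff)
    have ind_l: "ind (flip z l) = ind z"
    proof -
      have "(\<Prod>i\<in>I. flip z l $ i) = (\<Prod>i\<in>I. z $ i)" "(\<Prod>j\<in>J. 1 - flip z l $ j) = (\<Prod>j\<in>J. 1 - z $ j)"
        using l by (auto intro!: prod.cong simp: flip_def)
      then show ?thesis by (simp add: ind_def)
    qed
    let ?e = "\<lambda>v. (a \<bullet> v - b) * ind v"
    have flips: "?e (flip z i) \<ge> 0" for i
      using valid[OF ab flip_in_no_good_polytope[OF S z isolated]] ind_nonneg[OF f01]
      by (intro mult_nonneg_nonneg)
    have "a \<bullet> z - b + (a \<bullet> flip z l - b) \<ge> 0"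
      using valid[OF ab edge_midpoint_in_no_good_polytope[OF S z isolated[of l]]]
      by (simp add: inner_add_right)
    then have "(a \<bullet> z - b + (a \<bullet> flip z l - b)) * ind z \<ge> 0"
      using ind_nonneg[OF z01] by (rule mult_nonneg_nonneg)
    then have "0 \<le> ?e z + ?e (flip z l)" by (simp add: ind_l algebra_simps)
    also have "\<dots> \<le> ?e z + (\<Sum>i\<in>UNIV. ?e (flip z i))"
      using flips by (intro add_left_mono member_le_sum) auto
    finally have "0 \<le> ?c * (?e z + (\<Sum>i\<in>UNIV. ?e (flip z i)))"
      by (intro mult_nonneg_nonneg) auto
    also have "\<dots> = linearize y (sa_polynomial a b I J)"
      unfolding y_def linearize_centroid_moments
      by (simp add: linearize_vertex_sa_polynomial z01 f01 ind_def)
    finally show ?thesis .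
  qed
  moreover have "y {} = 1"
    by (simp add: y_def vertex_moments_empty field_simps)
  ultimately have "y \<in> sa_lifted k A" by (auto simp: sa_lifted_def)
  moreover have "corner_centroid z UNIV = (\<chi> i. y {i})"
    by (simp add: vec_eq_iff corner_centroid_def y_def vertex_moments_def)
  ultimately show ?thesis by (auto simp: sherali_adams_def)
qed

theorem theorem6:
  fixes S :: "(real ^ 'n) set"
  assumes "S \<subseteq> zero_one_points"
    and "S \<noteq> {}"
  shows "(\<exists>T. branch_and_bound_tree T \<and> num_nodes T \<le> 3 * CARD('n) * card S \<and>
            tree_hull T (no_good_polytope S) = integer_hull (no_good_polytope S))
    \<and> (card S = 1 \<longrightarrow>
        (\<forall>A. describes A (no_good_polytope S) \<longrightarrow>
           sherali_adams (CARD('n) - 1) A \<noteq> integer_hull (no_good_polytope S)))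
    \<and> ((\<exists>z\<in>S. {z'. l1_norm (z' - z) = 1} \<inter> S = {}) \<longrightarrow>
        lift_project_iter (CARD('n) - 1) (no_good_polytope S) \<noteq> integer_hull (no_good_polytope S))"
proof (intro conjI impI allI)
  obtain js :: "'n list" where js: "set js = UNIV" "distinct js"
    using finite_distinct_list[of "UNIV :: 'n set"] by auto
  then have len: "length js = CARD('n)" by (metis distinct_card)
  have "card S > 0"
    using assms finite_subset[OF assms(1) finite_zero_one_points] by (simp add: card_gt_0_iff)
  then have "CARD('n) * card S \<ge> 1" by (simp add: Suc_leI)
  then have "num_nodes (no_good_tree js S) \<le> 3 * CARD('n) * card S"
    using num_nodes_no_good_tree[OF assms(1), of js] unfolding len mult.assoc by linarith
  moreover have "branch_and_bound_tree (no_good_tree js S)"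
    using js by (simp add: branch_and_bound_tree_def admissible_no_good_tree)
  ultimately show "\<exists>T. branch_and_bound_tree T \<and> num_nodes T \<le> 3 * CARD('n) * card S \<and>
      tree_hull T (no_good_polytope S) = integer_hull (no_good_polytope S)"
    using tree_hull_no_good_tree[OF assms(1) js(1)] by blast
next
  fix A assume "card S = 1" and A: "describes A (no_good_polytope S)"
  then obtain z where z: "S = {z}" by (auto simp: card_1_singleton_iff)
  have "flip z i \<notin> S" for i
    using z assms(1) l1_norm_flip[of z i] by (auto simp: l1_norm_def)
  then have "corner_centroid z UNIV \<in> sherali_adams (CARD('n) - 1) A"
    using z A assms(1) by (intro corner_centroid_in_sherali_adams) auto
  then show "sherali_adams (CARD('n) - 1) A \<noteq> integer_hull (no_good_polytope S)"
    using corner_centroid_notin_integer_hull[OF assms(1), of z UNIV] z by auto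
next
  assume "\<exists>z\<in>S. {z'. l1_norm (z' - z) = 1} \<inter> S = {}"
  then obtain z where z: "z \<in> S" "{z'. l1_norm (z' - z) = 1} \<inter> S = {}" by blast
  have "flip z i \<notin> S" for i
    using z assms(1) l1_norm_flip[of z i] by auto
  then have "corner_centroid z UNIV \<in> lift_project_iter (CARD('n) - 1) (no_good_polytope S)"
    using z(1) assms(1) by (intro corner_centroid_in_lift_project_iter) auto
  then show "lift_project_iter (CARD('n) - 1) (no_good_polytope S)
      \<noteq> integer_hull (no_good_polytope S)"
    using corner_centroid_notin_integer_hull[OF assms(1) z(1), of UNIV] by auto
qed

end
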